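(* Let $B$ be an infinite set and let $E$ be an exact lim-rim over $B$. Then the Transfer Principle holds: for every first-order sentence $\varphi$ (with equality) built from relation symbols standing for relations $R\subset B^n$ (with $n$ arbitrary), if $\varphi$ is true in $B$ (each symbol interpreted by its relation $R$ and quantifiers ranging over $B$), then $\varphi$ is true in $E$ when each symbol is interpreted by the transferred relation ${}^*R\subset E^n$, equality by equality, and quantifiers range over $E$.
   Context: For sets $B,E$, a cylinder of $B^E$ is a subset of the form $\{\psi\in B^E:\psi|_J\in R\}$ with $J\subset E$ finite and $R\subset B^J$; the cylinders form a Boolean algebra. A lim-rim over $B$ is a set $E$ together with an ultrafilter $\mathcal L$ in the cylinder Boolean algebra of $B^E$. For $R\subset B^n$ the transferred relation is ${}^*R=\{(e_1,\dots,e_n)\in E^n:\{\psi\in B^E:(\psi_{e_1},\dots,\psi_{e_n})\in R\}\in\mathcal L\}$. For a finite set $I$ and $\eta\in E^I$, let $\mathcal L_\eta$ be the ultrafilter on $B^I$ consisting of the $C\subset B^I$ with $\{\psi\in B^E:\psi\circ\eta\in C\}\in\mathcal L$. A map $\xi:I\to J$ of finite sets induces maps $E^J\to E^I$, $\zeta\mapsto\zeta\circ\xi$, and $B^J\to B^I$, hence a pushforward $\xi_\sharp$ from ultrafilters on $B^J$ to ultrafilters on $B^I$. The lim-rim is exact if for all finite $I,J$ and all $\xi:I\to J$: whenever $\eta\in E^I$ and an ultrafilter $\mathcal U$ on $B^J$ satisfy $\mathcal L_\eta=\xi_\sharp\mathcal U$, there is $\zeta\in E^J$ with $\zeta\circ\xi=\eta$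 and $\mathcal L_\zeta=\mathcal U$. *)

theory Defs
  imports "HOL-Library.FuncSet"
begin

text \<open>
  Powers \<open>B\<^sup>E\<close>, \<open>B\<^sup>I\<close>, \<open>E\<^sup>I\<close> are the extensional function spaces
  \<open>E \<rightarrow>\<^sub>E B\<close> etc. of \<^theory>\<open>HOL-Library.FuncSet\<close>, so that restriction is \<^const>\<open>restrict\<close> and
  \<open>\<psi> \<circ> \<eta>\<close> on \<open>I\<close> is \<open>compose I \<psi> \<eta>\<close>.
\<close>

definition cylinders :: "'b set \<Rightarrow> 'e set \<Rightarrow> ('e \<Rightarrow> 'b) set set" where
  "cylinders B E =
     {{\<psi> \<in> E \<rightarrow>\<^sub>E B. restrict \<psi> J \<in> R} | J R. finite J \<and> J \<subseteq> E \<and> R \<subseteq> (J \<rightarrow>\<^sub>E B)}"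

text \<open>Ultrafilters in a Boolean algebra \<open>\<A>\<close> of subsets of \<open>X\<close>.\<close>

definition ultrafilter_in :: "'a set \<Rightarrow> 'a set set \<Rightarrow> 'a set set \<Rightarrow> bool" where
  "ultrafilter_in X \<A> \<U> \<longleftrightarrow>
     \<U> \<subseteq> \<A> \<and> X \<in> \<U> \<and> {} \<notin> \<U> \<and>
     (\<forall>A\<in>\<U>. \<forall>A'\<in>\<U>. A \<inter> A' \<in> \<U>) \<and>
     (\<forall>A\<in>\<U>. \<forall>A'\<in>\<A>. A \<subseteq> A' \<longrightarrow> A' \<in> \<U>) \<and>
     (\<forall>A\<in>\<A>. A \<in> \<U> \<or> X - A \<in> \<U>)"

abbreviation ultrafilter_on :: "'a set \<Rightarrow> 'a set set \<Rightarrow> bool" where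
  "ultrafilter_on X \<equiv> ultrafilter_in X (Pow X)"

definition lim_rim :: "'b set \<Rightarrow> 'e set \<Rightarrow> ('e \<Rightarrow> 'b) set set \<Rightarrow> bool" where
  "lim_rim B E \<L> \<longleftrightarrow> ultrafilter_in (E \<rightarrow>\<^sub>E B) (cylinders B E) \<L>"

text \<open>The ultrafilter \<open>\<L>\<^sub>\<eta>\<close> on \<open>B\<^sup>I\<close>, for \<open>\<eta> \<in> E\<^sup>I\<close>.\<close>

definition tuple_ultrafilter ::
  "'b set \<Rightarrow> 'e set \<Rightarrow> ('e \<Rightarrow> 'b) set set \<Rightarrow> 'i set \<Rightarrow> ('i \<Rightarrow> 'e) \<Rightarrow> ('i \<Rightarrow> 'b) set set" where
  "tuple_ultrafilter B E \<L> I \<eta> =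
     {C. C \<subseteq> (I \<rightarrow>\<^sub>E B) \<and> {\<psi> \<in> E \<rightarrow>\<^sub>E B. compose I \<psi> \<eta> \<in> C} \<in> \<L>}"

text \<open>The pushforward \<open>\<xi>\<^sub>\<sharp> \<U>\<close> of an ultrafilter \<open>\<U>\<close> on \<open>B\<^sup>J\<close> along \<open>\<xi> : I \<rightarrow> J\<close>.\<close>

definition pushforward ::
  "'b set \<Rightarrow> 'i set \<Rightarrow> 'j set \<Rightarrow> ('i \<Rightarrow> 'j) \<Rightarrow> ('j \<Rightarrow> 'b) set set \<Rightarrow> ('i \<Rightarrow> 'b) set set" where
  "pushforward B I J \<xi> \<U> =
     {C. C \<subseteq> (I \<rightarrow>\<^sub>E B) \<and> {\<beta> \<in> J \<rightarrow>\<^sub>E B. compose I \<beta> \<xi> \<in> C} \<in> \<U>}"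

text \<open>
  HOL cannot quantify over all finite sets of all types here; finite sets of natural numbers
  represent every finite set up to bijection, and the condition is invariant under bijections.
\<close>

definition exact_lim_rim :: "'b set \<Rightarrow> 'e set \<Rightarrow> ('e \<Rightarrow> 'b) set set \<Rightarrow> bool" where
  "exact_lim_rim B E \<L> \<longleftrightarrow> lim_rim B E \<L> \<and>
     (\<forall>(I::nat set) (J::nat set). \<forall>\<xi> \<in> I \<rightarrow>\<^sub>E J. \<forall>\<eta> \<in> I \<rightarrow>\<^sub>E E. \<forall>\<U>.
        finite I \<and> finite J \<and> ultrafilter_on (J \<rightarrow>\<^sub>E B) \<U> \<and>
        tuple_ultrafilter B E \<L> I \<eta> = pushforward B I J \<xi> \<U> \<longrightarrow>
        (\<exists>\<zeta> \<in> J \<rightarrow>\<^sub>E E. compose I \<zeta> \<xi> = \<eta> \<and> tuple_ultrafilter B E \<L> J \<zeta> = \<U>))"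

text \<open>The \<open>n\<close>-tuples of elements of \<open>A\<close>, and the transferred relation \<open>\<^sup>*R\<close> of \<open>R \<subseteq> B\<^sup>n\<close>.\<close>

definition tuples :: "nat \<Rightarrow> 'a set \<Rightarrow> 'a list set" where
  "tuples n A = {xs \<in> lists A. length xs = n}"

definition transferred ::
  "'b set \<Rightarrow> 'e set \<Rightarrow> ('e \<Rightarrow> 'b) set set \<Rightarrow> nat \<Rightarrow> 'b list set \<Rightarrow> 'e list set" where
  "transferred B E \<L> n R = {es \<in> tuples n E. {\<psi> \<in> E \<rightarrow>\<^sub>E B. map \<psi> es \<in> R} \<in> \<L>}"

text \<open>First-order formulas with variables in \<^typ>\<open>nat\<close> and relation symbols in \<open>'r\<close>.\<close>

datatype 'r fm =
    Rel 'r "nat list"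
  | Eq nat nat
  | Neg "'r fm"
  | Conj "'r fm" "'r fm"
  | Disj "'r fm" "'r fm"
  | Impl "'r fm" "'r fm"
  | Exists nat "'r fm"
  | Forall nat "'r fm"

primrec free_vars :: "'r fm \<Rightarrow> nat set" where
  "free_vars (Rel r xs) = set xs"
| "free_vars (Eq x y) = {x, y}"
| "free_vars (Neg \<phi>) = free_vars \<phi>"
| "free_vars (Conj \<phi> \<psi>) = free_vars \<phi> \<union> free_vars \<psi>"
| "free_vars (Disj \<phi> \<psi>) = free_vars \<phi> \<union> free_vars \<psi>"
| "free_vars (Impl \<phi> \<psi>) = free_vars \<phi> \<union> free_vars \<psi>"
| "free_vars (Exists x \<phi>) = free_vars \<phi> - {x}"
| "free_vars (Forall x \<phi>) = free_vars \<phi> - {x}"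

primrec well_formed :: "('r \<Rightarrow> nat) \<Rightarrow> 'r fm \<Rightarrow> bool" where
  "well_formed ar (Rel r xs) \<longleftrightarrow> length xs = ar r"
| "well_formed ar (Eq x y) \<longleftrightarrow> True"
| "well_formed ar (Neg \<phi>) \<longleftrightarrow> well_formed ar \<phi>"
| "well_formed ar (Conj \<phi> \<psi>) \<longleftrightarrow> well_formed ar \<phi> \<and> well_formed ar \<psi>"
| "well_formed ar (Disj \<phi> \<psi>) \<longleftrightarrow> well_formed ar \<phi> \<and> well_formed ar \<psi>"
| "well_formed ar (Impl \<phi> \<psi>) \<longleftrightarrow> well_formed ar \<phi> \<and> well_formed ar \<psi>"
| "well_formed ar (Exists x \<phi>) \<longleftrightarrow> well_formed ar \<phi>"
| "well_formed ar (Forall x \<phi>) \<longleftrightarrow> well_formed ar \<phi>"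

definition sentence :: "('r \<Rightarrow> nat) \<Rightarrow> 'r fm \<Rightarrow> bool" where
  "sentence ar \<phi> \<longleftrightarrow> well_formed ar \<phi> \<and> free_vars \<phi> = {}"

primrec sat :: "'a set \<Rightarrow> ('r \<Rightarrow> 'a list set) \<Rightarrow> (nat \<Rightarrow> 'a) \<Rightarrow> 'r fm \<Rightarrow> bool" where
  "sat D \<rho> \<sigma> (Rel r xs) \<longleftrightarrow> map \<sigma> xs \<in> \<rho> r"
| "sat D \<rho> \<sigma> (Eq x y) \<longleftrightarrow> \<sigma> x = \<sigma> y"
| "sat D \<rho> \<sigma> (Neg \<phi>) \<longleftrightarrow> \<not> sat D \<rho> \<sigma> \<phi>"
| "sat D \<rho> \<sigma> (Conj \<phi> \<psi>) \<longleftrightarrow> sat D \<rho> \<sigma> \<phi> \<and> sat D \<rho> \<sigma> \<psi>"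
| "sat D \<rho> \<sigma> (Disj \<phi> \<psi>) \<longleftrightarrow> sat D \<rho> \<sigma> \<phi> \<or> sat D \<rho> \<sigma> \<psi>"
| "sat D \<rho> \<sigma> (Impl \<phi> \<psi>) \<longleftrightarrow> (sat D \<rho> \<sigma> \<phi> \<longrightarrow> sat D \<rho> \<sigma> \<psi>)"
| "sat D \<rho> \<sigma> (Exists x \<phi>) \<longleftrightarrow> (\<exists>d\<in>D. sat D \<rho> (\<sigma>(x := d)) \<phi>)"
| "sat D \<rho> \<sigma> (Forall x \<phi>) \<longleftrightarrow> (\<forall>d\<in>D. sat D \<rho> (\<sigma>(x := d)) \<phi>)"

text \<open>
  For a sentence the truth value does not depend on the assignment; assignments are not
  required to take values in \<open>D\<close>, so this is also correct for an empty domain.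
\<close>

definition true_in :: "'a set \<Rightarrow> ('r \<Rightarrow> 'a list set) \<Rightarrow> 'r fm \<Rightarrow> bool" where
  "true_in D \<rho> \<phi> \<longleftrightarrow> (\<forall>\<sigma>. sat D \<rho> \<sigma> \<phi>)"

lemma sat_cong_free_vars:
  assumes "\<And>x. x \<in> free_vars \<phi> \<Longrightarrow> \<sigma> x = \<tau> x"
  shows "sat D \<rho> \<sigma> \<phi> \<longleftrightarrow> sat D \<rho> \<tau> \<phi>"
  using assms
proof (induction \<phi> arbitrary: \<sigma> \<tau>)
  case (Rel r xs)
  then have "map \<sigma> xs = map \<tau> xs" by simp
  then show ?case by (simp only: sat.simps)
next
  case (Neg \<phi>)
  from Neg.IH[of \<sigma> \<tau>] Neg.prems show ?case by simp
next
  case (Conj \<phi> \<psi>)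
  from Conj.IH(1)[of \<sigma> \<tau>] Conj.IH(2)[of \<sigma> \<tau>] Conj.prems show ?case by simp
next
  case (Disj \<phi> \<psi>)
  from Disj.IH(1)[of \<sigma> \<tau>] Disj.IH(2)[of \<sigma> \<tau>] Disj.prems show ?case by simp
next
  case (Impl \<phi> \<psi>)
  from Impl.IH(1)[of \<sigma> \<tau>] Impl.IH(2)[of \<sigma> \<tau>] Impl.prems show ?case by simp
next
  case (Exists x \<phi>)
  have "sat D \<rho> (\<sigma>(x := d)) \<phi> \<longleftrightarrow> sat D \<rho> (\<tau>(x := d)) \<phi>" for d
    by (rule Exists.IH) (use Exists.prems in auto)
  then show ?case by simp
next
  case (Forall x \<phi>)
  have "sat D \<rho> (\<sigma>(x := d)) \<phi> \<longleftrightarrow> sat D \<rho> (\<tau>(x := d)) \<phi>" for d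
    by (rule Forall.IH) (use Forall.prems in auto)
  then show ?case by simp
qed simp

end

theory Submission
  imports Defs
begin

text \<open>
  The proof is that of the theorem of Los, with exactness in the place of the choice of
  representatives in an ultrapower.  By induction on \<open>\<phi>\<close>, and for every assignment
  \<open>\<sigma>\<close> of elements of \<open>E\<close> to the free variables, \<open>\<phi>\<close> holds in \<open>E\<close> at \<open>\<sigma>\<close> if and only if
  \<open>\<L>\<close>-almost every \<open>\<psi> \<in> B\<^sup>E\<close> makes \<open>\<phi>\<close> true in \<open>B\<close> at \<open>\<psi> \<circ> \<sigma>\<close> (\<open>sat_iff_almost_everywhere\<close>).  Whether
  \<open>\<psi>\<close> does so depends on finitely many of its values, so the set of these \<open>\<psi>\<close> is a cylinder and
  \<open>\<L>\<close> decides it; the connectives are then immediate, and relation symbols are interpreted so as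
  to make the claim true.  For a sentence true in \<open>B\<close> this set is all of \<open>B\<^sup>E\<close>.

  Exactness enters twice.  For equations it is used with the map from a two-point set to a point:
  if \<open>\<psi> e = \<psi> e'\<close> for almost every \<open>\<psi>\<close>, then \<open>\<L>\<^sub>(\<^sub>e\<^sub>,\<^sub>e\<^sub>'\<^sub>)\<close> is the image of \<open>\<L>\<^sub>e\<close> under the diagonal,
  so \<open>(e, e')\<close> factors through the point (\<open>equal_if_almost_everywhere_equal\<close>).  For
  quantifiers it is used with the inclusion \<open>V \<subseteq> V \<union> {x}\<close> (\<open>witness_iff\<close>).  If almost every \<open>\<psi>\<close>
  has a witness \<open>b\<close> in \<open>B\<close>, then the solution set in \<open>B\<^bsup>V \<union> {x}\<^esup>\<close> meets the preimage of each member
  of \<open>\<L>\<^sub>\<eta>\<close>, where \<open>\<eta>\<close> is the tuple of parameters.  Hence some ultrafilter contains the solution set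
  and projects onto \<open>\<L>\<^sub>\<eta>\<close>; exactness realizes it by a tuple extending \<open>\<eta>\<close>, and the new entry of this
  tuple is the required witness in \<open>E\<close>.
\<close>

section \<open>Ultrafilters\<close>

lemma
  assumes "ultrafilter_in X \<A> \<U>"
  shows ultrafilter_in_subset: "\<U> \<subseteq> \<A>"
    and ultrafilter_in_top: "X \<in> \<U>"
    and ultrafilter_in_not_empty: "{} \<notin> \<U>"
    and ultrafilter_in_Int: "A \<in> \<U> \<Longrightarrow> A' \<in> \<U> \<Longrightarrow> A \<inter> A' \<in> \<U>"
    and ultrafilter_in_mono: "A \<in> \<U> \<Longrightarrow> A' \<in> \<A> \<Longrightarrow> A \<subseteq> A' \<Longrightarrow> A' \<in> \<U>"
    and ultrafilter_in_cases: "A \<in> \<A> \<Longrightarrow> A \<in> \<U> \<or> X - A \<in> \<U>"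
  using assms unfolding ultrafilter_in_def by blast+

lemma ultrafilter_in_Diff_iff:
  assumes "ultrafilter_in X \<A> \<U>" and "A \<in> \<A>"
  shows "X - A \<in> \<U> \<longleftrightarrow> A \<notin> \<U>"
proof -
  have "A \<inter> (X - A) = {}" by blast
  then show ?thesis
    using ultrafilter_in_Int[OF assms(1), of A "X - A"] ultrafilter_in_cases[OF assms]
      ultrafilter_in_not_empty[OF assms(1)] by auto
qed

text \<open>
  By Zorn's lemma there is a maximal \<open>\<inter>\<close>-closed family \<open>M\<close> of nonempty sets containing the given one.
  Maximality says that \<open>M\<close> contains every set that meets all members of \<open>M\<close>, and this
  gives all the properties of an ultrafilter.
\<close>

lemma ultrafilter_on_extending:
  assumes "\<D> \<noteq> {}" and "\<D> \<subseteq> Pow X" and "{} \<notin> \<D>"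
    and "\<And>A A'. A \<in> \<D> \<Longrightarrow> A' \<in> \<D> \<Longrightarrow> A \<inter> A' \<in> \<D>"
  obtains \<U> where "ultrafilter_on X \<U>" and "\<D> \<subseteq> \<U>"
proof -
  define \<F> where "\<F> = {M. \<D> \<subseteq> M \<and> M \<subseteq> Pow X \<and> {} \<notin> M \<and> (\<forall>A\<in>M. \<forall>A'\<in>M. A \<inter> A' \<in> M)}"
  have "\<exists>M\<in>\<F>. \<forall>N\<in>\<F>. M \<subseteq> N \<longrightarrow> N = M"
  proof (rule subset_Zorn_nonempty)
    have "\<D> \<in> \<F>" using assms unfolding \<F>_def by simp
    then show "\<F> \<noteq> {}" by blast
    fix \<C> assume ne: "\<C> \<noteq> {}" and ch: "subset.chain \<F> \<C>"
    have sub: "\<C> \<subseteq> \<F>" and lin: "\<And>M N. M \<in> \<C> \<Longrightarrow> N \<in> \<C> \<Longrightarrow> M \<subseteq> N \<or> N \<subseteq> M"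
      using ch unfolding subset_chain_def by blast+
    have "A \<inter> A' \<in> \<Union>\<C>" if A: "A \<in> \<Union>\<C>" "A' \<in> \<Union>\<C>" for A A'
    proof -
      obtain M N where "M \<in> \<C>" "A \<in> M" "N \<in> \<C>" "A' \<in> N" using A by blast
      with lin[of M N] obtain K where "K \<in> \<C>" "A \<in> K" "A' \<in> K" by blast
      moreover from this have "A \<inter> A' \<in> K" using sub unfolding \<F>_def by blast
      ultimately show ?thesis by blast
    qed
    moreover have "\<D> \<subseteq> \<Union>\<C>" "\<Union>\<C> \<subseteq> Pow X" "{} \<notin> \<Union>\<C>"
      using ne sub unfolding \<F>_def by blast+
    ultimately show "\<Union>\<C> \<in> \<F>" unfolding \<F>_def by simp
  qed
  then obtain M where MF: "M \<in> \<F>" and max: "\<And>N. N \<in> \<F> \<Longrightarrow> M \<subseteq> N \<Longrightarrow> N = M" by blast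
  have M: "\<D> \<subseteq> M" "M \<subseteq> Pow X" "{} \<notin> M" "\<And>A A'. A \<in> M \<Longrightarrow> A' \<in> M \<Longrightarrow> A \<inter> A' \<in> M"
    using MF unfolding \<F>_def by blast+
  have meets: "A \<in> M" if A: "A \<subseteq> X" and int: "\<And>m. m \<in> M \<Longrightarrow> m \<inter> A \<noteq> {}" for A
  proof -
    \<comment> \<open>the filter generated by \<open>M\<close> and \<open>A\<close>\<close>
    define N where "N = {N. N \<subseteq> X \<and> (\<exists>m\<in>M. m \<inter> A \<subseteq> N)}"
    have MN: "M \<subseteq> N" using M(2) unfolding N_def by blast
    have "K \<inter> K' \<in> N" if K: "K \<in> N" "K' \<in> N" for K K'
    proof -
      obtain m m' where "m \<in> M" "m' \<in> M" "m \<inter> A \<subseteq> K" "m' \<inter> A \<subseteq> K'" "K \<subseteq> X" "K' \<subseteq> X"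
        using K unfolding N_def by blast
      moreover have "m \<inter> m' \<in> M" using M(4) calculation by blast
      ultimately show ?thesis unfolding N_def by blast
    qed
    moreover have "{} \<notin> N" using int unfolding N_def by blast
    moreover have "N \<subseteq> Pow X" unfolding N_def by blast
    ultimately have "N \<in> \<F>" using MN M(1) unfolding \<F>_def by blast
    then have "N = M" using max MN by blast
    moreover have "A \<in> N" using A assms(1) M(1) unfolding N_def by blast
    ultimately show ?thesis by simp
  qed
  have ne: "m \<inter> m' \<noteq> {}" if "m \<in> M" "m' \<in> M" for m m'
    using M(3,4) that by metis
  have "X \<in> M"
    by (rule meets) (use ne M(2) in blast)+
  moreover have "A' \<in> M" if "A \<in> M" "A' \<subseteq> X" "A \<subseteq> A'" for A A'
    by (rule meets) (use ne that in blast)+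
  moreover have "A \<in> M \<or> X - A \<in> M" if A: "A \<subseteq> X" for A
  proof (cases "\<forall>m\<in>M. m \<inter> A \<noteq> {}")
    case True
    then show ?thesis using meets A by blast
  next
    case False
    then obtain m where m: "m \<in> M" "m \<inter> A = {}" by blast
    have "X - A \<in> M"
      by (rule meets) (use ne m M(2) in blast)+
    then show ?thesis ..
  qed
  ultimately have "ultrafilter_on X M"
    using M(2,3,4) unfolding ultrafilter_in_def by simp
  then show thesis using that M(1) by blast
qed

lemma ultrafilter_on_eqI:
  assumes U: "ultrafilter_on X \<U>" and V: "ultrafilter_on X \<V>" and "\<U> \<subseteq> \<V>"
  shows "\<U> = \<V>"
proof (rule antisym[OF assms(3)], rule subsetI)
  fix A assume A: "A \<in> \<V>"
  then have "A \<in> Pow X" using ultrafilter_in_subset[OF V] by blast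
  moreover from this have "X - A \<notin> \<V>" using ultrafilter_in_Diff_iff[OF V] A by blast
  ultimately show "A \<in> \<U>" using ultrafilter_in_cases[OF U] assms(3) by blast
qed

section \<open>Cylinders and induced ultrafilters\<close>

text \<open>
  Predicates on all functions, not only on those in \<open>B\<^sup>V\<close>: the maps \<open>\<psi> \<circ> \<sigma>\<close> to which they are
  applied are arbitrary outside the free variables of a formula.
\<close>

definition depends_only_on :: "'i set \<Rightarrow> (('i \<Rightarrow> 'b) \<Rightarrow> bool) \<Rightarrow> bool" where
  "depends_only_on V P \<longleftrightarrow> (\<forall>\<beta> \<beta>'. (\<forall>v\<in>V. \<beta> v = \<beta>' v) \<longrightarrow> P \<beta> = P \<beta>')"

lemma depends_only_onD:
  "depends_only_on V P \<Longrightarrow> (\<And>v. v \<in> V \<Longrightarrow> \<beta> v = \<beta>' v) \<Longrightarrow> P \<beta> = P \<beta>'"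
  unfolding depends_only_on_def by blast

lemma cylinder_Collect:
  assumes "finite J" and "J \<subseteq> E" and P: "depends_only_on J P"
  shows "{\<psi> \<in> E \<rightarrow>\<^sub>E B. P \<psi>} \<in> cylinders B E"
proof -
  have "P (restrict \<psi> J) = P \<psi>" for \<psi>
    by (rule depends_only_onD[OF P]) simp
  then have "{\<psi> \<in> E \<rightarrow>\<^sub>E B. P \<psi>} = {\<psi> \<in> E \<rightarrow>\<^sub>E B. restrict \<psi> J \<in> {\<beta> \<in> J \<rightarrow>\<^sub>E B. P \<beta>}}"
    using assms(2) by (auto simp: PiE_iff)
  then show ?thesis
    using assms(1,2) unfolding cylinders_def by blast
qed

lemma cylinder_Collect_comp:
  assumes "finite V" and "\<sigma> ` V \<subseteq> E" and P: "depends_only_on V P"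
  shows "{\<psi> \<in> E \<rightarrow>\<^sub>E B. P (\<psi> \<circ> \<sigma>)} \<in> cylinders B E"
proof (rule cylinder_Collect)
  show "depends_only_on (\<sigma> ` V) (\<lambda>\<psi>. P (\<psi> \<circ> \<sigma>))"
    unfolding depends_only_on_def by (auto intro!: depends_only_onD[OF P])
qed (use assms in auto)

lemma cylinder_compose:
  assumes "finite I" and "\<eta> \<in> I \<rightarrow>\<^sub>E E"
  shows "{\<psi> \<in> E \<rightarrow>\<^sub>E B. compose I \<psi> \<eta> \<in> C} \<in> cylinders B E"
proof (rule cylinder_Collect)
  show "depends_only_on (\<eta> ` I) (\<lambda>\<psi>. compose I \<psi> \<eta> \<in> C)"
    unfolding depends_only_on_def
    by (auto simp: compose_def cong: restrict_cong)
qed (use assms in auto)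

lemma compose_in_PiE: "\<eta> \<in> I \<rightarrow>\<^sub>E E \<Longrightarrow> \<psi> \<in> E \<rightarrow>\<^sub>E B \<Longrightarrow> compose I \<psi> \<eta> \<in> I \<rightarrow>\<^sub>E B"
  by (auto simp: compose_def PiE_iff)

text \<open>
  Both constructions of ultrafilters on \<open>B\<^sup>I\<close>, \<open>\<L>\<^sub>\<eta>\<close> and \<open>\<xi>\<^sub>\<sharp> \<U>\<close>, are instances of this.  Preimages are
  required to lie in \<open>\<A>\<close> because \<open>\<L>\<close> decides only cylinders.
\<close>

lemma ultrafilter_on_image:
  assumes U: "ultrafilter_in X \<A> \<U>" and f: "\<And>x. x \<in> X \<Longrightarrow> f x \<in> Y"
    and pre: "\<And>C. C \<subseteq> Y \<Longrightarrow> {x \<in> X. f x \<in> C} \<in> \<A>"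
  shows "ultrafilter_on Y {C. C \<subseteq> Y \<and> {x \<in> X. f x \<in> C} \<in> \<U>}" (is "ultrafilter_on Y ?V")
proof -
  have "{x \<in> X. f x \<in> Y} = X" using f by blast
  then have top: "Y \<in> ?V" using ultrafilter_in_top[OF U] by simp
  have bot: "{} \<notin> ?V" using ultrafilter_in_not_empty[OF U] by simp
  have int: "C \<inter> C' \<in> ?V" if C: "C \<in> ?V" "C' \<in> ?V" for C C'
  proof -
    have "{x \<in> X. f x \<in> C \<inter> C'} = {x \<in> X. f x \<in> C} \<inter> {x \<in> X. f x \<in> C'}" by blast
    with ultrafilter_in_Int[OF U, of "{x \<in> X. f x \<in> C}" "{x \<in> X. f x \<in> C'}"] C
    show ?thesis by auto
  qed
  have mono: "C' \<in> ?V" if C: "C \<in> ?V" "C' \<subseteq> Y" "C \<subseteq> C'" for C C'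
    using ultrafilter_in_mono[OF U _ pre[OF C(2)], of "{x \<in> X. f x \<in> C}"] C by blast
  have compl: "C \<in> ?V \<or> Y - C \<in> ?V" if C: "C \<subseteq> Y" for C
  proof -
    have "{x \<in> X. f x \<in> Y - C} = X - {x \<in> X. f x \<in> C}" using f by blast
    with ultrafilter_in_cases[OF U pre[OF C]] C show ?thesis by auto
  qed
  show ?thesis
    unfolding ultrafilter_in_def
    apply (intro conjI ballI impI)
    subgoal by blast
    subgoal by (rule top)
    subgoal by (rule bot)
    subgoal by (rule int)
    subgoal using mono by blast
    subgoal using compl by blast
    done
qed

lemma ultrafilter_on_tuple_ultrafilter:
  assumes "lim_rim B E \<L>" and "finite I" and "\<eta> \<in> I \<rightarrow>\<^sub>E E"
  shows "ultrafilter_on (I \<rightarrow>\<^sub>E B) (tuple_ultrafilter B E \<L> I \<eta>)"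
  unfolding tuple_ultrafilter_def
proof (rule ultrafilter_on_image)
  show "ultrafilter_in (E \<rightarrow>\<^sub>E B) (cylinders B E) \<L>"
    using assms(1) unfolding lim_rim_def .
  show "compose I \<psi> \<eta> \<in> I \<rightarrow>\<^sub>E B" if "\<psi> \<in> E \<rightarrow>\<^sub>E B" for \<psi>
    by (rule compose_in_PiE[OF assms(3) that])
qed (rule cylinder_compose[OF assms(2,3)])

lemma ultrafilter_on_pushforward:
  assumes "ultrafilter_on (J \<rightarrow>\<^sub>E B) \<U>" and "\<xi> \<in> I \<rightarrow>\<^sub>E J"
  shows "ultrafilter_on (I \<rightarrow>\<^sub>E B) (pushforward B I J \<xi> \<U>)"
  unfolding pushforward_def
proof (rule ultrafilter_on_image[OF assms(1)])
  show "compose I \<beta> \<xi> \<in> I \<rightarrow>\<^sub>E B" if "\<beta> \<in> J \<rightarrow>\<^sub>E B" for \<beta>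
    by (rule compose_in_PiE[OF assms(2) that])
qed blast

section \<open>Consequences of exactness\<close>

lemma exact_lim_rim_ultrafilter:
  "exact_lim_rim B E \<L> \<Longrightarrow> ultrafilter_in (E \<rightarrow>\<^sub>E B) (cylinders B E) \<L>"
  unfolding exact_lim_rim_def lim_rim_def by (rule conjunct1)

lemma exact_lim_rimD:
  fixes I J :: "nat set"
  assumes "exact_lim_rim B E \<L>" and "finite I" and "finite J"
    and "\<xi> \<in> I \<rightarrow>\<^sub>E J" and "\<eta> \<in> I \<rightarrow>\<^sub>E E" and "ultrafilter_on (J \<rightarrow>\<^sub>E B) \<U>"
    and "tuple_ultrafilter B E \<L> I \<eta> = pushforward B I J \<xi> \<U>"
  obtains \<zeta> where "\<zeta> \<in> J \<rightarrow>\<^sub>E E" and "compose I \<zeta> \<xi> = \<eta>"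
    and "tuple_ultrafilter B E \<L> J \<zeta> = \<U>"
  using assms unfolding exact_lim_rim_def by blast

text \<open>
  The tuple \<open>(e, e')\<close> and the ultrafilter \<open>\<L>\<^sub>e\<close> satisfy the hypothesis of exactness for the map from
  \<open>{0, 1}\<close> to \<open>{0}\<close>; a tuple that factors through this map has equal entries.
\<close>

lemma equal_if_almost_everywhere_equal:
  fixes B :: "'b set" and E :: "'e set"
  assumes ex: "exact_lim_rim B E \<L>" and e: "e \<in> E" "e' \<in> E"
    and ae: "{\<psi> \<in> E \<rightarrow>\<^sub>E B. \<psi> e = \<psi> e'} \<in> \<L>"
  shows "e = e'"
proof -
  define I :: "nat set" where "I = {0, 1}"
  define J :: "nat set" where "J = {0}"
  define \<eta> where "\<eta> = (\<lambda>i\<in>I. if i = 0 then e else e')"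
  define \<xi> :: "nat \<Rightarrow> nat" where "\<xi> = (\<lambda>i\<in>I. 0)"
  define \<epsilon> :: "nat \<Rightarrow> 'e" where "\<epsilon> = (\<lambda>i\<in>J. e)"
  have lr: "lim_rim B E \<L>" using ex unfolding exact_lim_rim_def by blast
  then have uf: "ultrafilter_in (E \<rightarrow>\<^sub>E B) (cylinders B E) \<L>" unfolding lim_rim_def .
  have fin: "finite I" "finite J" unfolding I_def J_def by auto
  have \<eta>: "\<eta> \<in> I \<rightarrow>\<^sub>E E" and \<xi>: "\<xi> \<in> I \<rightarrow>\<^sub>E J" and \<epsilon>: "\<epsilon> \<in> J \<rightarrow>\<^sub>E E"
    using e unfolding \<eta>_def \<xi>_def \<epsilon>_def J_def by auto
  let ?U = "tuple_ultrafilter B E \<L> J \<epsilon>"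
  have U: "ultrafilter_on (J \<rightarrow>\<^sub>E B) ?U"
    by (rule ultrafilter_on_tuple_ultrafilter[OF lr fin(2) \<epsilon>])
  have "tuple_ultrafilter B E \<L> I \<eta> = pushforward B I J \<xi> ?U"
  proof (rule ultrafilter_on_eqI)
    show "ultrafilter_on (I \<rightarrow>\<^sub>E B) (tuple_ultrafilter B E \<L> I \<eta>)"
      by (rule ultrafilter_on_tuple_ultrafilter[OF lr fin(1) \<eta>])
    show "ultrafilter_on (I \<rightarrow>\<^sub>E B) (pushforward B I J \<xi> ?U)"
      by (rule ultrafilter_on_pushforward[OF U \<xi>])
    show "tuple_ultrafilter B E \<L> I \<eta> \<subseteq> pushforward B I J \<xi> ?U"
    proof
      fix C assume "C \<in> tuple_ultrafilter B E \<L> I \<eta>"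
      then have C: "C \<subseteq> I \<rightarrow>\<^sub>E B" and CL: "{\<psi> \<in> E \<rightarrow>\<^sub>E B. compose I \<psi> \<eta> \<in> C} \<in> \<L>"
        unfolding tuple_ultrafilter_def by auto
      let ?C' = "{\<beta> \<in> J \<rightarrow>\<^sub>E B. compose I \<beta> \<xi> \<in> C}"
      have "{\<psi> \<in> E \<rightarrow>\<^sub>E B. compose J \<psi> \<epsilon> \<in> ?C'} \<in> \<L>"
      proof (rule ultrafilter_in_mono[OF uf ultrafilter_in_Int[OF uf CL ae] cylinder_compose[OF fin(2) \<epsilon>]])
        have "compose J \<psi> \<epsilon> \<in> J \<rightarrow>\<^sub>E B" if "\<psi> \<in> E \<rightarrow>\<^sub>E B" for \<psi>
          by (rule compose_in_PiE[OF \<epsilon> that])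
        moreover have "compose I (compose J \<psi> \<epsilon>) \<xi> = compose I \<psi> \<eta>" if "\<psi> e = \<psi> e'" for \<psi> :: "'e \<Rightarrow> 'b"
          using that by (auto simp: fun_eq_iff compose_def \<xi>_def \<eta>_def \<epsilon>_def J_def)
        ultimately show "{\<psi> \<in> E \<rightarrow>\<^sub>E B. compose I \<psi> \<eta> \<in> C} \<inter> {\<psi> \<in> E \<rightarrow>\<^sub>E B. \<psi> e = \<psi> e'}
            \<subseteq> {\<psi> \<in> E \<rightarrow>\<^sub>E B. compose J \<psi> \<epsilon> \<in> ?C'}" by auto
      qed
      then show "C \<in> pushforward B I J \<xi> ?U"
        using C unfolding pushforward_def tuple_ultrafilter_def by auto
    qed
  qed
  from exact_lim_rimD[OF ex fin \<xi> \<eta> U this] obtain \<zeta> where z: "compose I \<zeta> \<xi> = \<eta>" by blast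
  have "e = compose I \<zeta> \<xi> 0" "e' = compose I \<zeta> \<xi> 1"
    unfolding z by (simp_all add: \<eta>_def I_def)
  then show ?thesis by (simp add: compose_def \<xi>_def I_def)
qed

text \<open>
  The amalgamation behind the quantifier step.  A set \<open>S\<close> whose projection is large for \<open>\<L>\<^sub>\<eta>\<close> meets
  the preimage of every member of \<open>\<L>\<^sub>\<eta>\<close>, so it belongs to an ultrafilter with image \<open>\<L>\<^sub>\<eta>\<close>, to which
  exactness applies.
\<close>

lemma exact_lift:
  fixes I J :: "nat set"
  assumes ex: "exact_lim_rim B E \<L>" and fin: "finite I" "finite J"
    and \<xi>: "\<xi> \<in> I \<rightarrow>\<^sub>E J" and \<eta>: "\<eta> \<in> I \<rightarrow>\<^sub>E E" and S: "S \<subseteq> J \<rightarrow>\<^sub>E B"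
    and proj: "(\<lambda>\<beta>. compose I \<beta> \<xi>) ` S \<in> tuple_ultrafilter B E \<L> I \<eta>"
  obtains \<zeta> where "\<zeta> \<in> J \<rightarrow>\<^sub>E E" and "compose I \<zeta> \<xi> = \<eta>"
    and "S \<in> tuple_ultrafilter B E \<L> J \<zeta>"
proof -
  let ?T = "tuple_ultrafilter B E \<L> I \<eta>"
  have "lim_rim B E \<L>" using ex unfolding exact_lim_rim_def by blast
  then have T: "ultrafilter_on (I \<rightarrow>\<^sub>E B) ?T"
    using ultrafilter_on_tuple_ultrafilter fin(1) \<eta> by blast
  define lift where "lift C = {\<beta> \<in> S. compose I \<beta> \<xi> \<in> C}" for C
  have lift_int: "lift C \<inter> lift C' = lift (C \<inter> C')" for C C'
    unfolding lift_def by blast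
  have lift_ne: "lift C \<noteq> {}" if "C \<in> ?T" for C
  proof
    assume "lift C = {}"
    then have "C \<inter> (\<lambda>\<beta>. compose I \<beta> \<xi>) ` S = {}" unfolding lift_def by blast
    then show False
      using ultrafilter_in_Int[OF T that proj] ultrafilter_in_not_empty[OF T] by simp
  qed
  obtain \<U> where U: "ultrafilter_on (J \<rightarrow>\<^sub>E B) \<U>" and sub: "lift ` ?T \<subseteq> \<U>"
  proof (rule ultrafilter_on_extending)
    show "lift ` ?T \<noteq> {}" using proj by blast
    show "lift ` ?T \<subseteq> Pow (J \<rightarrow>\<^sub>E B)" using S unfolding lift_def by blast
    show "{} \<notin> lift ` ?T" using lift_ne by (metis imageE)
    fix A A' assume "A \<in> lift ` ?T" "A' \<in> lift ` ?T"
    then obtain C C' where "C \<in> ?T" "C' \<in> ?T" "A = lift C" "A' = lift C'" by blast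
    then show "A \<inter> A' \<in> lift ` ?T"
      unfolding \<open>A = _\<close> \<open>A' = _\<close> lift_int using ultrafilter_in_Int[OF T] by blast
  qed
  have "?T = pushforward B I J \<xi> \<U>"
  proof (rule ultrafilter_on_eqI[OF T ultrafilter_on_pushforward[OF U \<xi>]], rule subsetI)
    fix C assume C: "C \<in> ?T"
    have "{\<beta> \<in> J \<rightarrow>\<^sub>E B. compose I \<beta> \<xi> \<in> C} \<in> \<U>"
      by (rule ultrafilter_in_mono[OF U, of "lift C"]) (use S C sub in \<open>auto simp: lift_def\<close>)
    then show "C \<in> pushforward B I J \<xi> \<U>"
      using C ultrafilter_in_subset[OF T] unfolding pushforward_def by blast
  qed
  from exact_lim_rimD[OF ex fin \<xi> \<eta> U this] obtain \<zeta>
    where z: "\<zeta> \<in> J \<rightarrow>\<^sub>E E" "compose I \<zeta> \<xi> = \<eta>" "tuple_ultrafilter B E \<L> J \<zeta> = \<U>" .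
  have "lift (I \<rightarrow>\<^sub>E B) \<in> \<U>" using sub ultrafilter_in_top[OF T] by blast
  then have "S \<in> \<U>"
    by (rule ultrafilter_in_mono[OF U]) (use S in \<open>auto simp: lift_def\<close>)
  with z show thesis using that by blast
qed

text \<open>
  If almost every \<open>\<psi>\<close> has a witness in \<open>B\<close>, then the projection of the solution set of \<open>P\<close> is large
  for the tuple of parameters, and lifting along the inclusion \<open>F - {x} \<subseteq> (F - {x}) \<union> {x}\<close> adds an
  entry \<open>d\<close> at \<open>x\<close>.  Conversely \<open>d \<in> E\<close> gives the witness \<open>\<psi> d\<close>.
\<close>

lemma witness_iff:
  fixes B :: "'b set" and E :: "'e set" and x :: nat
  assumes ex: "exact_lim_rim B E \<L>" and fin: "finite F" and \<sigma>: "\<sigma> ` (F - {x}) \<subseteq> E"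
    and P: "depends_only_on F P"
  shows "(\<exists>d\<in>E. {\<psi> \<in> E \<rightarrow>\<^sub>E B. P (\<psi> \<circ> \<sigma>(x := d))} \<in> \<L>) \<longleftrightarrow>
    {\<psi> \<in> E \<rightarrow>\<^sub>E B. \<exists>b\<in>B. P ((\<psi> \<circ> \<sigma>)(x := b))} \<in> \<L>" (is "?L \<longleftrightarrow> ?R \<in> \<L>")
proof
  have uf: "ultrafilter_in (E \<rightarrow>\<^sub>E B) (cylinders B E) \<L>"
    by (rule exact_lim_rim_ultrafilter[OF ex])
  have upd: "\<psi> \<circ> \<sigma>(x := d) = (\<psi> \<circ> \<sigma>)(x := \<psi> d)" for \<psi> :: "'e \<Rightarrow> 'b" and d
    by (auto simp: fun_eq_iff)
  have dep: "depends_only_on (F - {x}) (\<lambda>\<beta>. \<exists>b\<in>B. P (\<beta>(x := b)))"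
    unfolding depends_only_on_def
    by (intro allI impI bex_cong refl depends_only_onD[OF P]) auto
  {
    assume ?L
    then obtain d where d: "d \<in> E" "{\<psi> \<in> E \<rightarrow>\<^sub>E B. P (\<psi> \<circ> \<sigma>(x := d))} \<in> \<L>" by blast
    show "?R \<in> \<L>"
    proof (rule ultrafilter_in_mono[OF uf d(2)])
      show "?R \<in> cylinders B E"
        by (rule cylinder_Collect_comp[OF _ \<sigma> dep]) (use fin in simp)
      show "{\<psi> \<in> E \<rightarrow>\<^sub>E B. P (\<psi> \<circ> \<sigma>(x := d))} \<subseteq> ?R"
        using d(1) unfolding upd by (auto simp: PiE_iff)
    qed
  next
    assume R: "?R \<in> \<L>"
    define V where "V = F - {x}"
    define J where "J = insert x V"
    define \<xi> :: "nat \<Rightarrow> nat" where "\<xi> = (\<lambda>v\<in>V. v)"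
    define \<eta> where "\<eta> = restrict \<sigma> V"
    define S where "S = {\<beta> \<in> J \<rightarrow>\<^sub>E B. P \<beta>}"
    have fins: "finite V" "finite J" using fin unfolding V_def J_def by auto
    have \<xi>: "\<xi> \<in> V \<rightarrow>\<^sub>E J" and \<eta>: "\<eta> \<in> V \<rightarrow>\<^sub>E E"
      using \<sigma> unfolding \<xi>_def \<eta>_def J_def V_def by auto
    have "{\<psi> \<in> E \<rightarrow>\<^sub>E B. compose V \<psi> \<eta> \<in> (\<lambda>\<beta>. compose V \<beta> \<xi>) ` S} \<in> \<L>"
    proof (rule ultrafilter_in_mono[OF uf R cylinder_compose[OF fins(1) \<eta>]], safe)
      fix \<psi> b assume \<psi>: "\<psi> \<in> E \<rightarrow>\<^sub>E B" and b: "b \<in> B" "P ((\<psi> \<circ> \<sigma>)(x := b))"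
      let ?\<beta> = "restrict ((\<psi> \<circ> \<sigma>)(x := b)) J"
      have "P ?\<beta> = P ((\<psi> \<circ> \<sigma>)(x := b))"
        by (rule depends_only_onD[OF P]) (auto simp: J_def V_def)
      then have "?\<beta> \<in> S"
        using \<psi> b \<sigma> by (auto simp: S_def J_def V_def PiE_iff)
      moreover have "compose V \<psi> \<eta> = compose V ?\<beta> \<xi>"
        by (auto simp: fun_eq_iff compose_def \<eta>_def \<xi>_def J_def V_def)
      ultimately show "compose V \<psi> \<eta> \<in> (\<lambda>\<beta>. compose V \<beta> \<xi>) ` S" by blast
    qed
    moreover have "(\<lambda>\<beta>. compose V \<beta> \<xi>) ` S \<subseteq> V \<rightarrow>\<^sub>E B"
      using compose_in_PiE[OF \<xi>] unfolding S_def by blast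
    ultimately have "(\<lambda>\<beta>. compose V \<beta> \<xi>) ` S \<in> tuple_ultrafilter B E \<L> V \<eta>"
      unfolding tuple_ultrafilter_def by simp
    moreover have "S \<subseteq> J \<rightarrow>\<^sub>E B" unfolding S_def by blast
    ultimately obtain \<zeta> where z: "\<zeta> \<in> J \<rightarrow>\<^sub>E E" "compose V \<zeta> \<xi> = \<eta>"
      "S \<in> tuple_ultrafilter B E \<L> J \<zeta>"
      using exact_lift[OF ex fins \<xi> \<eta>] by blast
    have zv: "\<zeta> v = \<sigma> v" if "v \<in> V" for v
      using fun_cong[OF z(2), of v] that by (simp add: compose_def \<xi>_def \<eta>_def)
    have zx: "\<zeta> x \<in> E" using z(1) unfolding J_def by auto
    have "P (compose J \<psi> \<zeta>) = P (\<psi> \<circ> \<sigma>(x := \<zeta> x))" for \<psi>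
      by (rule depends_only_onD[OF P]) (auto simp: compose_def J_def V_def zv)
    moreover have "compose J \<psi> \<zeta> \<in> J \<rightarrow>\<^sub>E B" if "\<psi> \<in> E \<rightarrow>\<^sub>E B" for \<psi>
      by (rule compose_in_PiE[OF z(1) that])
    ultimately have "{\<psi> \<in> E \<rightarrow>\<^sub>E B. compose J \<psi> \<zeta> \<in> S} = {\<psi> \<in> E \<rightarrow>\<^sub>E B. P (\<psi> \<circ> \<sigma>(x := \<zeta> x))}"
      unfolding S_def by blast
    then show ?L using z(3) zx unfolding tuple_ultrafilter_def by auto
  }
qed

section \<open>The transfer principle\<close>

lemma finite_free_vars: "finite (free_vars \<phi>)"
  by (induction \<phi>) auto

lemma depends_only_on_sat: "depends_only_on (free_vars \<phi>) (\<lambda>\<sigma>. sat D \<rho> \<sigma> \<phi>)"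
  unfolding depends_only_on_def using sat_cong_free_vars by blast

text \<open>
  The analogue of the theorem of Los.  The assignment is generalized in the induction because the
  quantifier step applies the hypothesis to \<open>\<sigma>(x := d)\<close>; \<open>Disj\<close>, \<open>Impl\<close> and \<open>Forall\<close> are
  reduced to \<open>Neg\<close>, \<open>Conj\<close> and \<open>Exists\<close>, as \<open>\<L>\<close> commutes with complements and intersections.
\<close>

theorem sat_iff_almost_everywhere:
  assumes ex: "exact_lim_rim B E \<L>"
    and "well_formed ar \<phi>" and "\<sigma> ` free_vars \<phi> \<subseteq> E"
  shows "sat E (\<lambda>r. transferred B E \<L> (ar r) (\<rho> r)) \<sigma> \<phi> \<longleftrightarrow>
    {\<psi> \<in> E \<rightarrow>\<^sub>E B. sat B \<rho> (\<psi> \<circ> \<sigma>) \<phi>} \<in> \<L>"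
  using assms(2,3)
proof (induction \<phi> arbitrary: \<sigma>)
  have uf: "ultrafilter_in (E \<rightarrow>\<^sub>E B) (cylinders B E) \<L>"
    by (rule exact_lim_rim_ultrafilter[OF ex])
  have cyl: "{\<psi> \<in> E \<rightarrow>\<^sub>E B. sat B \<rho> (\<psi> \<circ> \<sigma>) \<phi>} \<in> cylinders B E"
    if "\<sigma> ` free_vars \<phi> \<subseteq> E" for \<sigma> \<phi>
    by (rule cylinder_Collect_comp[OF finite_free_vars that depends_only_on_sat])
  have neg: "{\<psi> \<in> E \<rightarrow>\<^sub>E B. \<not> sat B \<rho> (\<psi> \<circ> \<sigma>) \<phi>} \<in> \<L> \<longleftrightarrow>
      {\<psi> \<in> E \<rightarrow>\<^sub>E B. sat B \<rho> (\<psi> \<circ> \<sigma>) \<phi>} \<notin> \<L>" if "\<sigma> ` free_vars \<phi> \<subseteq> E" for \<sigma> \<phi>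
  proof -
    have "{\<psi> \<in> E \<rightarrow>\<^sub>E B. \<not> sat B \<rho> (\<psi> \<circ> \<sigma>) \<phi>} = (E \<rightarrow>\<^sub>E B) - {\<psi> \<in> E \<rightarrow>\<^sub>E B. sat B \<rho> (\<psi> \<circ> \<sigma>) \<phi>}"
      by blast
    then show ?thesis using ultrafilter_in_Diff_iff[OF uf cyl[OF that]] by simp
  qed
  have conj: "{\<psi> \<in> E \<rightarrow>\<^sub>E B. sat B \<rho> (\<psi> \<circ> \<sigma>) (Conj \<phi> \<chi>)} \<in> \<L> \<longleftrightarrow>
      {\<psi> \<in> E \<rightarrow>\<^sub>E B. sat B \<rho> (\<psi> \<circ> \<sigma>) \<phi>} \<in> \<L> \<and> {\<psi> \<in> E \<rightarrow>\<^sub>E B. sat B \<rho> (\<psi> \<circ> \<sigma>) \<chi>} \<in> \<L>"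
    (is "?AB \<in> \<L> \<longleftrightarrow> ?A \<in> \<L> \<and> ?B \<in> \<L>")
    if "\<sigma> ` free_vars \<phi> \<subseteq> E" "\<sigma> ` free_vars \<chi> \<subseteq> E" for \<sigma> \<phi> \<chi>
  proof -
    have eq: "?AB = ?A \<inter> ?B" by auto
    have "?A \<in> \<L>" if "?A \<inter> ?B \<in> \<L>"
      by (rule ultrafilter_in_mono[OF uf that cyl[OF \<open>\<sigma> ` free_vars \<phi> \<subseteq> E\<close>] Int_lower1])
    moreover have "?B \<in> \<L>" if "?A \<inter> ?B \<in> \<L>"
      by (rule ultrafilter_in_mono[OF uf that cyl[OF \<open>\<sigma> ` free_vars \<chi> \<subseteq> E\<close>] Int_lower2])
    moreover have "?A \<inter> ?B \<in> \<L>" if "?A \<in> \<L>" "?B \<in> \<L>"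
      by (rule ultrafilter_in_Int[OF uf that])
    ultimately show ?thesis unfolding eq by iprover
  qed
  {
    case (Rel r xs)
    then have "map \<sigma> xs \<in> tuples (ar r) E" by (auto simp: tuples_def)
    then show ?case by (simp add: transferred_def comp_def)
  next
    case (Eq x y)
    then have e: "\<sigma> x \<in> E" "\<sigma> y \<in> E" by auto
    show ?case
      using equal_if_almost_everywhere_equal[OF ex e] ultrafilter_in_top[OF uf] by auto
  next
    case (Neg \<phi>)
    then show ?case using neg[of \<sigma> \<phi>] by (simp add: comp_def)
  next
    case (Conj \<phi> \<chi>)
    then have "\<sigma> ` free_vars \<phi> \<subseteq> E" "\<sigma> ` free_vars \<chi> \<subseteq> E" by auto
    then show ?case using conj[of \<sigma> \<phi> \<chi>] Conj by (simp add: comp_def)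
  next
    case (Disj \<phi> \<chi>)
    then have s: "\<sigma> ` free_vars \<phi> \<subseteq> E" "\<sigma> ` free_vars \<chi> \<subseteq> E" by auto
    then show ?case
      using conj[of \<sigma> "Neg \<phi>" "Neg \<chi>"] neg[of \<sigma> "Conj (Neg \<phi>) (Neg \<chi>)"] neg[of \<sigma> \<phi>] neg[of \<sigma> \<chi>] Disj
      by (auto simp: image_Un comp_def)
  next
    case (Impl \<phi> \<chi>)
    then have s: "\<sigma> ` free_vars \<phi> \<subseteq> E" "\<sigma> ` free_vars \<chi> \<subseteq> E" by auto
    then show ?case
      using conj[of \<sigma> \<phi> "Neg \<chi>"] neg[of \<sigma> "Conj \<phi> (Neg \<chi>)"] neg[of \<sigma> \<chi>] Impl
      by (auto simp: image_Un comp_def)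
  next
    case (Exists x \<phi>)
    then have s: "\<sigma> ` (free_vars \<phi> - {x}) \<subseteq> E" and wf: "well_formed ar \<phi>" by simp_all
    have "sat E (\<lambda>r. transferred B E \<L> (ar r) (\<rho> r)) (\<sigma>(x := d)) \<phi> \<longleftrightarrow>
        {\<psi> \<in> E \<rightarrow>\<^sub>E B. sat B \<rho> (\<psi> \<circ> \<sigma>(x := d)) \<phi>} \<in> \<L>" if "d \<in> E" for d
      by (rule Exists.IH[OF wf]) (use s that in auto)
    then show ?case
      using witness_iff[OF ex finite_free_vars s depends_only_on_sat, of B \<rho>] by (simp add: comp_def)
  next
    case (Forall x \<phi>)
    then have s: "\<sigma> ` (free_vars (Neg \<phi>) - {x}) \<subseteq> E" and wf: "well_formed ar \<phi>" by simp_all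
    have "sat E (\<lambda>r. transferred B E \<L> (ar r) (\<rho> r)) (\<sigma>(x := d)) \<phi> \<longleftrightarrow>
        \<not> {\<psi> \<in> E \<rightarrow>\<^sub>E B. sat B \<rho> (\<psi> \<circ> \<sigma>(x := d)) (Neg \<phi>)} \<in> \<L>" if "d \<in> E" for d
    proof -
      have d: "(\<sigma>(x := d)) ` free_vars \<phi> \<subseteq> E" using s that by auto
      have "sat E (\<lambda>r. transferred B E \<L> (ar r) (\<rho> r)) (\<sigma>(x := d)) \<phi> \<longleftrightarrow>
          {\<psi> \<in> E \<rightarrow>\<^sub>E B. sat B \<rho> (\<psi> \<circ> \<sigma>(x := d)) \<phi>} \<in> \<L>"
        by (rule Forall.IH[OF wf d])
      then show ?thesis using neg[OF d] by simp
    qed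
    then have "sat E (\<lambda>r. transferred B E \<L> (ar r) (\<rho> r)) \<sigma> (Forall x \<phi>) \<longleftrightarrow>
        \<not> (\<exists>d\<in>E. {\<psi> \<in> E \<rightarrow>\<^sub>E B. sat B \<rho> (\<psi> \<circ> \<sigma>(x := d)) (Neg \<phi>)} \<in> \<L>)"
      by simp
    also have "\<dots> \<longleftrightarrow> \<not> {\<psi> \<in> E \<rightarrow>\<^sub>E B. sat B \<rho> (\<psi> \<circ> \<sigma>) (Exists x (Neg \<phi>))} \<in> \<L>"
      using witness_iff[OF ex finite_free_vars s depends_only_on_sat, of B \<rho>] by (simp add: comp_def)
    also have "\<dots> \<longleftrightarrow> {\<psi> \<in> E \<rightarrow>\<^sub>E B. sat B \<rho> (\<psi> \<circ> \<sigma>) (Forall x \<phi>)} \<in> \<L>"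
      using neg[of \<sigma> "Exists x (Neg \<phi>)"] s by simp
    finally show ?case .
  }
qed

theorem mainTheorem4:
  fixes B :: "'b set" and E :: "'e set" and \<L> :: "('e \<Rightarrow> 'b) set set"
    and ar :: "'r \<Rightarrow> nat" and \<rho> :: "'r \<Rightarrow> 'b list set" and \<phi> :: "'r fm"
  assumes "infinite B"
    and "exact_lim_rim B E \<L>"
    and "\<And>r. \<rho> r \<subseteq> tuples (ar r) B"
    and "sentence ar \<phi>"
    and "true_in B \<rho> \<phi>"
  shows "true_in E (\<lambda>r. transferred B E \<L> (ar r) (\<rho> r)) \<phi>"
  unfolding true_in_def
proof
  fix \<sigma> :: "nat \<Rightarrow> 'e"
  have "well_formed ar \<phi>" "\<sigma> ` free_vars \<phi> \<subseteq> E"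
    using assms(4) unfolding sentence_def by auto
  moreover have "{\<psi> \<in> E \<rightarrow>\<^sub>E B. sat B \<rho> (\<psi> \<circ> \<sigma>) \<phi>} = E \<rightarrow>\<^sub>E B"
    using assms(5) unfolding true_in_def by simp
  ultimately show "sat E (\<lambda>r. transferred B E \<L> (ar r) (\<rho> r)) \<sigma> \<phi>"
    using ultrafilter_in_top[OF exact_lim_rim_ultrafilter[OF assms(2)]]
    by (simp add: sat_iff_almost_everywhere[OF assms(2)])
qed

end
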